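(* Let $\bm{A}\in\mathbb{R}^{m\times n}$, $\lambda>0$, $\alpha\in(0,1)$, $\gamma\in(0,1)$. Let $\bar{\bm{x}}\in\mathbb{R}^n$ have support $\mathcal{S}=\{i:\bar x_i\neq 0\}$ with $s=|\mathcal{S}|\ge 1$, let $\bm{b}=\bm{A}\bar{\bm{x}}$, and assume $\|\bar{\bm{x}}\|_2\le R$ for some constant $R>0$. Assume that $\gamma\ge \frac{2R}{2R+\sqrt{s}}$. Let $\bm{x}^*\in\mathbb{R}^n$ satisfy $\mathcal{H}(\bm{x}^* )\le \mathcal{H}(\bar{\bm{x}})$, where $$\mathcal{H}(\bm{x})=\tfrac12\|\bm{A}\bm{x}-\bm{b}\|_2^2+\lambda\left(\gamma(\|\bm{x}\|_1-\alpha\|\bm{x}\|_2)+(1-\gamma)\|\bm{x}\|_2^2\right).$$ Suppose that $\bm{A}$ satisfies DCEN-REC$(s,s,\beta)$ with $\beta:=2\alpha+\sqrt{s}$, i.e. $\phi_\beta(s,s)>0$. Define $\Gamma:=\lambda\gamma(2\sqrt{s}+\alpha)$. Then: (i) (oracle inequality) $$\tfrac12\|\bm{A}\bm{x}^*-\bm{b}\|_2^2+\lambda\gamma\left(\|\bm{x}^*_{\mathcal{S}^c}\|_1-\alpha\|\bm{x}^*_{\mathcal{S}^c}\|_2\right)\le \frac{2\Gamma^2}{\phi_\beta^2(s,s)};$$ (ii) (recovery bound) $$\|\bm{x}^*-\bar{\bm{x}}\|_2^2\le \frac{\Gamma^2}{\phi_\beta^4(s,s)}\left(4+\frac{\Ga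mma^2}{4s\lambda^2\gamma^2(1-\alpha)^2}\right).$$
   Context: For an index set $\mathcal{I}\subseteq\{1,\dots,n\}$, $\bm{x}_{\mathcal{I}}$ is the restriction of $\bm{x}$ to the coordinates in $\mathcal{I}$, and $\mathcal{I}^c$ is the complement of $\mathcal{I}$. Restricted eigenvalue condition: for $\beta>0$ and positive integers $s,t$, the matrix $\bm{A}$ satisfies DCEN-REC$(s,t,\beta)$ if $$\phi_\beta(s,t):=\min\left\{\frac{\|\bm{A}\bm{x}\|_2}{\|\bm{x}_{\mathcal{J}}\|_2}: |\mathcal{I}|\le s,\ \|\bm{x}_{\mathcal{I}^c}\|_1\le\|\bm{x}_{\mathcal{I}}\|_1+\beta\|\bm{x}\|_2,\ \mathcal{J}=\mathcal{I}\cup\mathcal{I}(\bm{x};t)\right\}>0,$$ where the minimum is over nonzero $\bm{x}\in\mathbb{R}^n$ and index sets $\mathcal{I}\subseteq\{1,\dots,n\}$, and $\mathcal{I}(\bm{x};t)$ denotes the index set of the $t$ largest coordinates in absolute value of $\bm{x}$ in $\mathcal{I}^c$. *)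

theory Defs
  imports "HOL-Analysis.Analysis"
begin

definition l1norm :: "real ^ 'n \<Rightarrow> real" where
  "l1norm x = (\<Sum>i\<in>UNIV. \<bar>x $ i\<bar>)"

text \<open>The restriction of a vector to an index set is kept in the ambient space, with zeros
  outside the set; this does not affect the norms.\<close>

definition restr :: "'n set \<Rightarrow> real ^ 'n \<Rightarrow> real ^ 'n" where
  "restr I x = (\<chi> i. if i \<in> I then x $ i else 0)"

text \<open>\<open>K\<close> is an index set of the \<open>t\<close> largest coordinates in absolute value of \<open>x\<close> outside \<open>I\<close>.
  Ties may be broken arbitrarily, hence a predicate rather than a function; all of the complement
  is taken if it has fewer than \<open>t\<close> elements. The norm of \<open>restr (I \<union> K) x\<close> does not depend on
  how ties are broken.\<close>

definition largest_coords :: "real ^ 'n \<Rightarrow> 'n set \<Rightarrow> nat \<Rightarrow> 'n set \<Rightarrow> bool" where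
  "largest_coords x I t K \<longleftrightarrow>
     K \<subseteq> - I \<and> card K = min t (card (- I)) \<and>
     (\<forall>i\<in>K. \<forall>j\<in>- I - K. \<bar>x $ j\<bar> \<le> \<bar>x $ i\<bar>)"

definition rec_ratios :: "real ^ 'n ^ 'm \<Rightarrow> nat \<Rightarrow> nat \<Rightarrow> real \<Rightarrow> real set" where
  "rec_ratios A s t \<beta> =
     {norm (A *v x) / norm (restr J x) | x I J K.
        x \<noteq> 0 \<and> card I \<le> s \<and>
        l1norm (restr (- I) x) \<le> l1norm (restr I x) + \<beta> * norm x \<and>
        largest_coords x I t K \<and> J = I \<union> K}"

text \<open>The infimum is attained for positive \<open>s\<close>, \<open>t\<close>, \<open>\<beta>\<close>; see \<open>rec_const_is_minimum\<close> below.\<close>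

definition rec_const :: "real ^ 'n ^ 'm \<Rightarrow> nat \<Rightarrow> nat \<Rightarrow> real \<Rightarrow> real" where
  "rec_const A s t \<beta> = Inf (rec_ratios A s t \<beta>)"

definition DCEN_REC :: "real ^ 'n ^ 'm \<Rightarrow> nat \<Rightarrow> nat \<Rightarrow> real \<Rightarrow> bool" where
  "DCEN_REC A s t \<beta> \<longleftrightarrow> rec_const A s t \<beta> > 0"

definition dcen_objective ::
    "real ^ 'n ^ 'm \<Rightarrow> real ^ 'm \<Rightarrow> real \<Rightarrow> real \<Rightarrow> real \<Rightarrow> real ^ 'n \<Rightarrow> real" where
  "dcen_objective A b lam \<alpha> \<gamma> x =
     1/2 * (norm (A *v x - b))\<^sup>2 +
     lam * (\<gamma> * (l1norm x - \<alpha> * norm x) + (1 - \<gamma>) * (norm x)\<^sup>2)"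

lemma restr_scaleR: "restr I (c *\<^sub>R x) = c *\<^sub>R restr I x"
  by (simp add: restr_def vec_eq_iff)

lemma l1norm_scaleR: "l1norm (c *\<^sub>R x) = \<bar>c\<bar> * l1norm x"
  by (simp add: l1norm_def abs_mult sum_distrib_left)

lemma continuous_on_restr [continuous_intros]: "continuous_on S (restr I)"
  unfolding restr_def
proof (rule continuous_on_vec_lambda)
  fix i
  show "continuous_on S (\<lambda>x. if i \<in> I then x $ i else 0)"
    by (cases "i \<in> I") (auto intro!: continuous_intros)
qed

lemma continuous_on_l1norm: "continuous_on S l1norm"
  unfolding l1norm_def by (auto intro!: continuous_intros)

lemma restr_largest_nonzero:
  assumes "x \<noteq> 0" and "largest_coords x I t K" and "0 < t"
  shows "restr (I \<union> K) x \<noteq> 0"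
proof
  assume z: "restr (I \<union> K) x = 0"
  have zero: "x $ i = 0" if "i \<in> I \<union> K" for i
    using z that by (auto simp: restr_def vec_eq_iff split: if_splits)
  obtain j where j: "x $ j \<noteq> 0" using assms(1) by (auto simp: vec_eq_iff)
  hence jn: "j \<in> - I - K" using zero by auto
  hence "card (- I) > 0" by (auto simp: card_gt_0_iff)
  hence "K \<noteq> {}" using assms(2,3) by (auto simp: largest_coords_def min_def split: if_splits)
  then obtain i where "i \<in> K" by auto
  hence "\<bar>x $ j\<bar> \<le> \<bar>x $ i\<bar>" using assms(2) jn by (auto simp: largest_coords_def)
  thus False using zero[of i] \<open>i \<in> K\<close> j by auto
qed

lemma rec_ratios_nonempty:
  fixes A :: "real ^ 'n ^ 'm"
  assumes "0 < s" and "0 \<le> \<beta>"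
  shows "rec_ratios A s t \<beta> \<noteq> {}"
proof -
  obtain i :: 'n where True by blast
  let ?x = "axis i 1 :: real ^ 'n"
  obtain K where K: "K \<subseteq> - {i}" "card K = min t (card (- {i}))"
    using obtain_subset_with_card_n[of "min t (card (- {i}))" "- {i}"] by auto
  have r0: "restr (- {i}) ?x = 0" by (auto simp: restr_def vec_eq_iff axis_def)
  have "largest_coords ?x {i} t K"
    using K by (auto simp: largest_coords_def axis_def)
  moreover have "?x \<noteq> 0" by (simp add: axis_eq_0_iff)
  moreover have "l1norm (restr (- {i}) ?x) \<le> l1norm (restr {i} ?x) + \<beta> * norm ?x"
    unfolding r0 using assms(2) by (simp add: l1norm_def sum_nonneg)
  moreover have "card {i} \<le> s" using assms(1) by simp
  ultimately show ?thesis unfolding rec_ratios_def by blast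
qed

lemma compact_rec_ratios:
  fixes A :: "real ^ 'n ^ 'm"
  assumes "0 < t"
  shows "compact (rec_ratios A s t \<beta>)"
proof -
  define P where "P = {(I, K :: 'n set). card I \<le> s \<and> K \<subseteq> - I \<and> card K = min t (card (- I))}"
  define D where "D = (\<lambda>(I, K). {x :: real ^ 'n. norm x = 1 \<and>
      l1norm (restr (- I) x) \<le> l1norm (restr I x) + \<beta> * norm x \<and>
      (\<forall>i\<in>K. \<forall>j\<in>- I - K. \<bar>x $ j\<bar> \<le> \<bar>x $ i\<bar>)})"
  define f where "f = (\<lambda>(I, K) x. norm (A *v x) / norm (restr (I \<union> K :: 'n set) x))"
  have cl1: "continuous_on UNIV (\<lambda>x :: real ^ 'n. l1norm (restr I x))" for I
    by (rule continuous_on_compose2[OF continuous_on_l1norm[of UNIV] continuous_on_restr]) auto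
  have cD: "compact (D p)" for p
  proof -
    obtain I K where p: "p = (I, K)" by (cases p)
    have "closed (D p)" unfolding D_def p prod.case Ball_def
      by (intro closed_Collect_conj closed_Collect_all closed_Collect_imp closed_Collect_eq
          closed_Collect_le open_Collect_const continuous_intros cl1)
    moreover have "bounded (D p)" unfolding bounded_iff D_def p by (intro exI[of _ 1]) auto
    ultimately show ?thesis by (simp add: compact_eq_bounded_closed)
  qed
  have cf: "continuous_on (D p) (f p)" if "p \<in> P" for p
  proof -
    obtain I K where p: "p = (I, K)" by (cases p)
    have "restr (I \<union> K) x \<noteq> 0" if "x \<in> D p" for x
      using that \<open>p \<in> P\<close> assms unfolding p
      by (intro restr_largest_nonzero[of _ _ t]) (auto simp: D_def P_def largest_coords_def)
    thus ?thesis unfolding f_def p prod.case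
      by (intro continuous_intros matrix_vector_mult_linear_continuous_on) (auto simp: p)
  qed
  have "rec_ratios A s t \<beta> = (\<Union>p\<in>P. f p ` D p)"
  proof (intro equalityI subsetI)
    fix v assume "v \<in> rec_ratios A s t \<beta>"
    then obtain x I K where x: "v = norm (A *v x) / norm (restr (I \<union> K) x)" "x \<noteq> 0" "card I \<le> s"
      "l1norm (restr (- I) x) \<le> l1norm (restr I x) + \<beta> * norm x" "largest_coords x I t K"
      unfolding rec_ratios_def by blast
    define c where "c = 1 / norm x"
    have c: "c > 0" using x(2) by (simp add: c_def)
    have "c * l1norm (restr (- I) x) \<le> c * (l1norm (restr I x) + \<beta> * norm x)"
      using c x(4) by simp
    hence "c *\<^sub>R x \<in> D (I, K)"
      using c x(2,5) unfolding D_def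
      by (auto simp: restr_scaleR l1norm_scaleR largest_coords_def abs_mult algebra_simps)
         (simp add: c_def)
    moreover have "f (I, K) (c *\<^sub>R x) = v"
      using c by (simp add: f_def x(1) restr_scaleR matrix_vector_mult_scaleR)
    moreover have "(I, K) \<in> P" using x by (auto simp: P_def largest_coords_def)
    ultimately show "v \<in> (\<Union>p\<in>P. f p ` D p)" by blast
  next
    fix v assume "v \<in> (\<Union>p\<in>P. f p ` D p)"
    then obtain I K x where *: "(I, K) \<in> P" "x \<in> D (I, K)" "v = f (I, K) x" by auto
    have "x \<noteq> 0" using *(2) by (auto simp: D_def)
    moreover have "largest_coords x I t K" using * by (auto simp: D_def P_def largest_coords_def)
    ultimately show "v \<in> rec_ratios A s t \<beta>"
      using * unfolding rec_ratios_def P_def D_def f_def by auto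
  qed
  moreover have "finite P" by simp
  ultimately show ?thesis
    using cD cf by (auto intro!: compact_UN compact_continuous_image)
qed

lemma rec_const_is_minimum:
  fixes A :: "real ^ 'n ^ 'm"
  assumes "0 < s" and "0 < t" and "0 < \<beta>"
  shows "rec_const A s t \<beta> \<in> rec_ratios A s t \<beta>"
    and "\<forall>v\<in>rec_ratios A s t \<beta>. rec_const A s t \<beta> \<le> v"
proof -
  obtain m where m: "m \<in> rec_ratios A s t \<beta>" "\<forall>v\<in>rec_ratios A s t \<beta>. m \<le> v"
    using compact_attains_inf[OF compact_rec_ratios rec_ratios_nonempty] assms
    by (metis less_imp_le)
  hence "rec_const A s t \<beta> = m" unfolding rec_const_def by (intro cInf_eq_minimum) auto
  with m show "rec_const A s t \<beta> \<in> rec_ratios A s t \<beta>"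
    and "\<forall>v\<in>rec_ratios A s t \<beta>. rec_const A s t \<beta> \<le> v" by auto
qed

end

theory Submission
  imports Defs
begin

text \<open>Put \<open>h = xstar - xbar\<close>. The condition on \<open>\<gamma>\<close> says \<open>2 R (1 - \<gamma>) \<le> \<gamma> sqrt s\<close>, so the ridge term
  costs at most \<open>\<gamma> sqrt s * norm h\<^sub>S\<close>, and comparing objectives gives the basic inequality
  \<open>norm (A h)\<^sup>2 / 2 + lam \<gamma> (l1norm h\<^bsub>-S\<^esub> - \<alpha> norm h\<^bsub>-S\<^esub>) \<le> \<Gamma> norm h\<^sub>S\<close>, together with the cone
  condition for \<open>h\<close>. The restricted eigenvalue condition bounds \<open>norm h\<^sub>S \<le> norm h\<^sub>J\<close> by
  \<open>norm (A h) / \<phi>\<close>, and the resulting quadratic inequality in \<open>norm (A h)\<close> yields the first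
  bound. Outside \<open>J\<close> the entries of \<open>h\<close> are dominated by the average of the \<open>s\<close> largest
  entries outside \<open>S\<close>, so \<open>(norm h\<^bsub>-J\<^esub>)\<^sup>2 \<le> (l1norm h\<^bsub>-S\<^esub>)\<^sup>2 / s\<close>.\<close>

section \<open>Norms of restricted vectors\<close>

lemma l1norm_restr: "l1norm (restr I x) = (\<Sum>i\<in>I. \<bar>x $ i\<bar>)"
proof -
  have "l1norm (restr I x) = (\<Sum>i\<in>UNIV. if i \<in> I then \<bar>x $ i\<bar> else 0)"
    unfolding l1norm_def restr_def by (intro sum.cong) auto
  then show ?thesis by (simp add: sum.If_cases)
qed

lemma norm_restr_squared: "(norm (restr I x))\<^sup>2 = (\<Sum>i\<in>I. (x $ i)\<^sup>2)"
proof -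
  have "(norm (restr I x))\<^sup>2 = (\<Sum>i\<in>UNIV. if i \<in> I then (x $ i)\<^sup>2 else 0)"
    unfolding norm_vec_def L2_set_def restr_def by (simp add: sum_nonneg) (intro sum.cong, auto)
  then show ?thesis by (simp add: sum.If_cases)
qed

lemma norm_restr_squared_compl: "(norm (restr I x))\<^sup>2 + (norm (restr (- I) x))\<^sup>2 = (norm x)\<^sup>2"
proof -
  have "(norm x)\<^sup>2 = (norm (restr UNIV x))\<^sup>2" by (simp add: restr_def)
  then show ?thesis
    unfolding norm_restr_squared
    using sum.subset_diff[of I UNIV "\<lambda>i. (x $ i)\<^sup>2"] by (simp add: Compl_eq_Diff_UNIV)
qed

lemma l1norm_restr_compl: "l1norm (restr I x) + l1norm (restr (- I) x) = l1norm x"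
  unfolding l1norm_restr
  using sum.subset_diff[of I UNIV "\<lambda>i. \<bar>x $ i\<bar>"] by (simp add: l1norm_def Compl_eq_Diff_UNIV)

lemma norm_restr_mono:
  assumes "I \<subseteq> J"
  shows "norm (restr I x) \<le> norm (restr J x)"
proof -
  have "(norm (restr I x))\<^sup>2 \<le> (norm (restr J x))\<^sup>2"
    unfolding norm_restr_squared using assms by (intro sum_mono2) auto
  then show ?thesis by (rule power2_le_imp_le) simp
qed

lemma norm_restr_le: "norm (restr I x) \<le> norm x"
  using norm_restr_mono[of I UNIV x] by (simp add: restr_def)

lemma norm_le_l1norm: "norm x \<le> l1norm x"
  unfolding l1norm_def by (rule norm_le_l1_cart)

lemma l1norm_restr_le: "l1norm (restr I x) \<le> sqrt (card I) * norm (restr I x)"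
proof -
  have "(l1norm (restr I x))\<^sup>2 \<le> (norm (restr I x))\<^sup>2 * card I"
    unfolding l1norm_restr norm_restr_squared
    using sum_squared_le_sum_of_squares[of "\<lambda>i. \<bar>x $ i\<bar>" I] by simp
  then have "(l1norm (restr I x))\<^sup>2 \<le> (sqrt (card I) * norm (restr I x))\<^sup>2"
    by (simp add: power_mult_distrib mult.commute)
  then show ?thesis by (rule power2_le_imp_le) simp
qed

section \<open>Largest coordinates and the restricted eigenvalue\<close>

text \<open>Greedy choice: as long as \<open>- I\<close> is not exhausted, adjoin a remaining index
  of maximal absolute value; afterwards the same set keeps serving. This supplies the
  \<open>K\<close> with which the restricted eigenvalue condition is instantiated.\<close>

lemma largest_coords_exists: "\<exists>K. largest_coords x I t K"
proof (induction t)
  case 0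
  show ?case by (rule exI[of _ "{}"]) (simp add: largest_coords_def)
next
  case (Suc t)
  then obtain K where K: "largest_coords x I t K" by blast
  show ?case
  proof (cases "t < card (- I)")
    case False
    then show ?thesis using K by (intro exI[of _ K]) (auto simp: largest_coords_def min_def)
  next
    case True
    then have cK: "card K = t" and sub: "K \<subseteq> - I" using K by (auto simp: largest_coords_def)
    have "- I - K \<noteq> {}" using True cK card_mono[of K "- I"] by auto
    then have "Max ((\<lambda>j. \<bar>x $ j\<bar>) ` (- I - K)) \<in> (\<lambda>j. \<bar>x $ j\<bar>) ` (- I - K)"
      by (intro Max_in) auto
    then obtain j where j: "j \<in> - I - K" "Max ((\<lambda>j. \<bar>x $ j\<bar>) ` (- I - K)) = \<bar>x $ j\<bar>"
      by blast
    then have "\<forall>i\<in>- I - K. \<bar>x $ i\<bar> \<le> \<bar>x $ j\<bar>"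
      using Max_ge[of "(\<lambda>j. \<bar>x $ j\<bar>) ` (- I - K)"] by auto
    then have "largest_coords x I (Suc t) (insert j K)"
      using K cK True j(1) by (auto simp: largest_coords_def)
    then show ?thesis by blast
  qed
qed

lemma largest_coords_tail:
  fixes x :: "real ^ 'n"
  assumes "largest_coords x I t K"
  shows "real t * (norm (restr (- (I \<union> K)) x))\<^sup>2 \<le> (l1norm (restr (- I) x))\<^sup>2"
proof -
  let ?T = "- (I \<union> K)" and ?L = "l1norm (restr (- I) x)"
  have entry: "real t * \<bar>x $ j\<bar> \<le> ?L" if j: "j \<in> ?T" for j
  proof -
    \<comment> \<open>The index \<open>j\<close> witnesses that \<open>K\<close> does not exhaust
      \<open>- I\<close>, so the minimum in \<open>largest_coords\<close> is \<open>t\<close>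
      itself.\<close>
    have "K \<subset> - I" using assms j by (auto simp: largest_coords_def)
    then have "card K < card (- I)" by (simp add: psubset_card_mono)
    then have "card K = t" using assms by (auto simp: largest_coords_def)
    then have "real t * \<bar>x $ j\<bar> = (\<Sum>i\<in>K. \<bar>x $ j\<bar>)" by simp
    also have "\<dots> \<le> (\<Sum>i\<in>K. \<bar>x $ i\<bar>)"
      using assms j by (intro sum_mono) (auto simp: largest_coords_def)
    also have "\<dots> \<le> ?L"
      unfolding l1norm_restr using assms by (intro sum_mono2) (auto simp: largest_coords_def)
    finally show ?thesis .
  qed
  have "real t * (norm (restr ?T x))\<^sup>2 = (\<Sum>j\<in>?T. (real t * \<bar>x $ j\<bar>) * \<bar>x $ j\<bar>)"
    unfolding norm_restr_squared sum_distrib_left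
    by (intro sum.cong) (auto simp: power2_eq_square)
  also have "\<dots> \<le> (\<Sum>j\<in>?T. ?L * \<bar>x $ j\<bar>)"
    by (intro sum_mono mult_right_mono entry) auto
  also have "\<dots> = ?L * (\<Sum>j\<in>?T. \<bar>x $ j\<bar>)" by (simp add: sum_distrib_left)
  also have "\<dots> \<le> ?L * ?L"
  proof (rule mult_left_mono)
    show "(\<Sum>j\<in>?T. \<bar>x $ j\<bar>) \<le> ?L" unfolding l1norm_restr by (intro sum_mono2) auto
    show "0 \<le> ?L" by (simp add: l1norm_restr sum_nonneg)
  qed
  finally show ?thesis by (simp add: power2_eq_square)
qed

lemma rec_const_mult_norm_le:
  fixes A :: "real ^ 'n ^ 'm"
  assumes "0 < s" "0 < t" "0 < \<beta>" and "card I \<le> s"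
    and "l1norm (restr (- I) x) \<le> l1norm (restr I x) + \<beta> * norm x"
    and "largest_coords x I t K"
  shows "rec_const A s t \<beta> * norm (restr (I \<union> K) x) \<le> norm (A *v x)"
proof (cases "x = 0")
  case True
  moreover have "restr (I \<union> K) 0 = (0 :: real ^ 'n)" by (simp add: restr_def vec_eq_iff)
  ultimately show ?thesis by simp
next
  case False
  then have "norm (A *v x) / norm (restr (I \<union> K) x) \<in> rec_ratios A s t \<beta>"
    unfolding rec_ratios_def using assms by blast
  then have "rec_const A s t \<beta> \<le> norm (A *v x) / norm (restr (I \<union> K) x)"
    using rec_const_is_minimum(2)[of s t \<beta> A] assms(1-3) by blast
  moreover have "0 < norm (restr (I \<union> K) x)"
    using restr_largest_nonzero[OF False assms(6,2)] by simp
  ultimately show ?thesis by (simp add: pos_le_divide_eq)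
qed

section \<open>Comparing the objective at two points\<close>

text \<open>Off \<open>S\<close> the vectors \<open>x - y\<close> and \<open>x\<close> agree; on
  \<open>S\<close> the triangle inequality applies entrywise.\<close>

lemma l1norm_add_restr_diff_le:
  assumes "\<And>i. i \<notin> S \<Longrightarrow> y $ i = 0"
  shows "l1norm y + l1norm (restr (- S) (x - y)) \<le> l1norm x + l1norm (restr S (x - y))"
proof -
  have "l1norm y + l1norm (restr (- S) (x - y)) = (\<Sum>i\<in>S. \<bar>y $ i\<bar>) + (\<Sum>i\<in>- S. \<bar>x $ i\<bar>)"
    unfolding l1norm_restr l1norm_restr_compl[of S y, symmetric]
    using assms by (auto intro: sum.cong)
  also have "(\<Sum>i\<in>S. \<bar>y $ i\<bar>) \<le> (\<Sum>i\<in>S. \<bar>x $ i\<bar> + \<bar>(x - y) $ i\<bar>)"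
    by (intro sum_mono) simp
  finally show ?thesis
    unfolding l1norm_restr l1norm_restr_compl[of S x, symmetric] by (simp add: sum.distrib)
qed

text \<open>Expand the square of \<open>x = y + (x - y)\<close> and drop the square of the
  difference. Since \<open>y\<close> lives on \<open>S\<close>, the cross term sees only
  \<open>restr S (x - y)\<close>, and Cauchy-Schwarz finishes.\<close>

lemma norm_diff_squares_le:
  fixes x y :: "real ^ 'n"
  assumes "\<And>i. i \<notin> S \<Longrightarrow> y $ i = 0"
  shows "(norm y)\<^sup>2 - (norm x)\<^sup>2 \<le> 2 * norm y * norm (restr S (x - y))"
proof -
  have "y \<bullet> (x - y) = y \<bullet> restr S (x - y)"
    unfolding inner_vec_def restr_def by (intro sum.cong) (use assms in auto)
  then have "- (y \<bullet> (x - y)) \<le> norm y * norm (restr S (x - y))"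
    using Cauchy_Schwarz_ineq2[of y "restr S (x - y)"] by linarith
  moreover have "(norm y)\<^sup>2 - (norm x)\<^sup>2 = - 2 * (y \<bullet> (x - y)) - (norm (x - y))\<^sup>2"
    by (simp add: power2_norm_eq_inner inner_diff inner_commute)
  ultimately show ?thesis using zero_le_power2[of "norm (x - y)"] by linarith
qed

text \<open>The term \<open>norm x - norm y\<close> is left unestimated because it is bounded in two
  different ways later: by \<open>norm h\<close> for the cone condition, and by the two parts of
  \<open>h\<close> for the final estimate.\<close>

lemma dcen_basic_inequality:
  fixes A :: "real ^ 'n ^ 'm"
  assumes "0 < lam" "0 < \<gamma>" "\<gamma> < 1" "0 < R"
    and S: "\<And>i. i \<notin> S \<Longrightarrow> y $ i = 0"
    and "norm y \<le> R" and gam: "2 * R / (2 * R + sqrt (card S)) \<le> \<gamma>"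
    and obj: "dcen_objective A (A *v y) lam \<alpha> \<gamma> x \<le> dcen_objective A (A *v y) lam \<alpha> \<gamma> y"
  shows "1/2 * (norm (A *v (x - y)))\<^sup>2 + lam * \<gamma> * l1norm (restr (- S) (x - y))
    \<le> lam * \<gamma> * (l1norm (restr S (x - y)) + sqrt (card S) * norm (restr S (x - y))
        + \<alpha> * (norm x - norm y))"
proof -
  let ?h = "x - y"
  have "2 * R \<le> \<gamma> * (2 * R + sqrt (card S))"
    using gam \<open>0 < R\<close> by (simp add: pos_divide_le_eq add_pos_nonneg)
  then have R: "(1 - \<gamma>) * (2 * R) \<le> \<gamma> * sqrt (card S)" by (simp add: algebra_simps)
  have "(1 - \<gamma>) * ((norm y)\<^sup>2 - (norm x)\<^sup>2) \<le> (1 - \<gamma>) * (2 * R * norm (restr S ?h))"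
    using \<open>norm y \<le> R\<close> \<open>\<gamma> < 1\<close>
    by (intro mult_left_mono order_trans[OF norm_diff_squares_le[OF S, where x = x]])
       (auto intro!: mult_right_mono)
  also have "\<dots> \<le> \<gamma> * sqrt (card S) * norm (restr S ?h)"
    using mult_right_mono[OF R, of "norm (restr S ?h)"] by (simp add: mult.assoc)
  finally have ridge: "(1 - \<gamma>) * ((norm y)\<^sup>2 - (norm x)\<^sup>2) \<le> \<gamma> * sqrt (card S) * norm (restr S ?h)" .
  have "\<gamma> * (l1norm (restr (- S) ?h) + l1norm y) \<le> \<gamma> * (l1norm x + l1norm (restr S ?h))"
    using l1norm_add_restr_diff_le[OF S, where x = x] \<open>0 < \<gamma>\<close> by (simp add: add.commute)
  with ridge have "lam * (\<gamma> * (l1norm (restr (- S) ?h) + l1norm y)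
        + (1 - \<gamma>) * ((norm y)\<^sup>2 - (norm x)\<^sup>2))
      \<le> lam * (\<gamma> * (l1norm x + l1norm (restr S ?h)) + \<gamma> * sqrt (card S) * norm (restr S ?h))"
    using \<open>0 < lam\<close> by simp
  \<comment> \<open>The data are exactly \<open>A *v y\<close>, so the fit term of \<open>y\<close>
    is zero and that of \<open>x\<close> is the left-hand side.\<close>
  moreover have "1/2 * (norm (A *v ?h))\<^sup>2
      \<le> lam * (\<gamma> * (l1norm y - l1norm x + \<alpha> * (norm x - norm y))
        + (1 - \<gamma>) * ((norm y)\<^sup>2 - (norm x)\<^sup>2))"
    using obj unfolding dcen_objective_def
    by (simp add: algebra_simps)
  ultimately show ?thesis by (simp add: algebra_simps)
qed

section \<open>Oracle inequality and recovery bound\<close>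

theorem theorem9:
  fixes A :: "real ^ 'n ^ 'm"
    and b :: "real ^ 'm"
    and xbar xstar :: "real ^ 'n"
    and lam \<alpha> \<gamma> \<beta> \<Gamma> R :: real
    and S :: "'n set"
    and s :: nat
  assumes "lam > 0"
    and "0 < \<alpha>" "\<alpha> < 1"
    and "0 < \<gamma>" "\<gamma> < 1"
    and "S = {i. xbar $ i \<noteq> 0}"
    and "s = card S" "s \<ge> 1"
    and "b = A *v xbar"
    and "R > 0" "norm xbar \<le> R"
    and "\<gamma> \<ge> 2 * R / (2 * R + sqrt (real s))"
    and "dcen_objective A b lam \<alpha> \<gamma> xstar \<le> dcen_objective A b lam \<alpha> \<gamma> xbar"
    and "\<beta> = 2 * \<alpha> + sqrt (real s)"
    and "DCEN_REC A s s \<beta>"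
    and "\<Gamma> = lam * \<gamma> * (2 * sqrt (real s) + \<alpha>)"
  shows "(1/2 * (norm (A *v xstar - b))\<^sup>2
           + lam * \<gamma> * (l1norm (restr (- S) xstar) - \<alpha> * norm (restr (- S) xstar))
         \<le> 2 * \<Gamma>\<^sup>2 / (rec_const A s s \<beta>)\<^sup>2) \<and>
         ((norm (xstar - xbar))\<^sup>2
         \<le> \<Gamma>\<^sup>2 / (rec_const A s s \<beta>) ^ 4
             * (4 + \<Gamma>\<^sup>2 / (4 * real s * lam\<^sup>2 * \<gamma>\<^sup>2 * (1 - \<alpha>)\<^sup>2)))"
proof -
  define h where "h = xstar - xbar"
  define \<phi> where "\<phi> = rec_const A s s \<beta>"
  define r where "r = \<Gamma> / \<phi>"
  define a where "a = norm (A *v h)"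
  define L where "L = l1norm (restr (- S) h)"
  define N where "N = norm (restr (- S) h)"
  define u where "u = norm (restr S h)"
  note a_S = assms(6) and s = assms(7,8)
  have S: "\<And>i. i \<notin> S \<Longrightarrow> xbar $ i = 0" using a_S by auto
  have lg: "0 < lam * \<gamma>" using assms by simp
  have \<phi>: "0 < \<phi>" using assms(15) by (simp add: DCEN_REC_def \<phi>_def)
  have \<Gamma>: "0 < \<Gamma>" using lg assms(2,8,16) by (simp add: add_nonneg_pos)
  have r: "0 < r" using \<Gamma> \<phi> by (simp add: r_def)
  have nonneg: "0 \<le> a" "0 \<le> u" "0 \<le> N" by (simp_all add: a_def u_def N_def)
  have "N \<le> L" unfolding N_def L_def by (rule norm_le_l1norm)

  have h_off: "restr (- S) h = restr (- S) xstar"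
    using S by (simp add: h_def restr_def vec_eq_iff)
  have basic: "1/2 * a\<^sup>2 + lam * \<gamma> * L \<le> lam * \<gamma> *
      (l1norm (restr S h) + sqrt s * u + \<alpha> * (norm xstar - norm xbar))"
    unfolding a_def h_def L_def u_def s(1)
    by (rule dcen_basic_inequality[OF assms(1,4,5,10) _ assms(11) assms(12)[unfolded s(1)]
        assms(13)[unfolded assms(9)]]) (rule S)

  \<comment> \<open>First use of \<open>basic\<close>: crude bounds by \<open>norm h\<close> give
    the coefficient \<open>sqrt s + \<alpha>\<close>, which is at most \<beta>. Discarding the fit
    term then leaves the cone condition.\<close>
  have u_le: "u \<le> norm h" unfolding u_def by (rule norm_restr_le)
  have "norm xstar - norm xbar \<le> norm h" unfolding h_def by (rule norm_triangle_ineq2)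
  then have "sqrt s * u + \<alpha> * (norm xstar - norm xbar) \<le> sqrt s * norm h + \<alpha> * norm h"
    using u_le assms(2) by (intro add_mono mult_left_mono) auto
  also have "\<dots> \<le> \<beta> * norm h" using assms(2) by (simp add: assms(14) algebra_simps)
  finally have "sqrt s * u + \<alpha> * (norm xstar - norm xbar) \<le> \<beta> * norm h" .
  moreover have "L \<le> l1norm (restr S h) + sqrt s * u + \<alpha> * (norm xstar - norm xbar)"
    by (rule mult_left_le_imp_le[OF _ lg]) (use basic zero_le_power2[of a] in linarith)
  ultimately have cone: "L \<le> l1norm (restr S h) + \<beta> * norm h" by linarith

  obtain K where K: "largest_coords h S s K" using largest_coords_exists by blast
  define v where "v = norm (restr (S \<union> K) h)"
  have "\<phi> * v \<le> a"
    unfolding \<phi>_def v_def a_def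
    using rec_const_mult_norm_le[of s s \<beta> S h K A] s assms(2,14) cone K
    by (simp add: L_def add_pos_pos)
  then have v: "v \<le> a / \<phi>" using \<phi> by (simp add: pos_le_divide_eq mult.commute)
  have "u \<le> v" unfolding u_def v_def by (intro norm_restr_mono) auto

  \<comment> \<open>Second use of \<open>basic\<close>: splitting \<open>h\<close> along
    \<open>S\<close> leaves an \<open>\<alpha> * N\<close> that moves to the left-hand side. The
    factor in \<Gamma> collects \<open>sqrt s\<close> from the l1 norm on \<open>S\<close>,
    \<open>sqrt s\<close> from the ridge term, and \<alpha> from this split.\<close>
  have "norm xstar \<le> norm (xbar + restr S h) + N"
  proof -
    have "xstar = (xbar + restr S h) + restr (- S) h"
      by (simp add: h_def restr_def vec_eq_iff)
    then show ?thesis unfolding N_def by (metis norm_triangle_ineq)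
  qed
  then have "norm xstar - norm xbar \<le> u + N"
    using norm_triangle_ineq[of xbar "restr S h"] by (simp add: u_def)
  then have "\<alpha> * (norm xstar - norm xbar) \<le> \<alpha> * (u + N)" using assms(2) by simp
  moreover have "l1norm (restr S h) \<le> sqrt s * u"
    unfolding u_def s(1) by (rule l1norm_restr_le)
  ultimately have "l1norm (restr S h) + sqrt s * u + \<alpha> * (norm xstar - norm xbar)
      \<le> (2 * sqrt s + \<alpha>) * u + \<alpha> * N" by (simp add: algebra_simps)
  from order_trans[OF basic mult_left_mono[OF this]]
  have "1/2 * a\<^sup>2 + lam * \<gamma> * L \<le> lam * \<gamma> * ((2 * sqrt s + \<alpha>) * u + \<alpha> * N)" using lg by simp
  then have "1/2 * a\<^sup>2 + lam * \<gamma> * (L - \<alpha> * N) \<le> \<Gamma> * u"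
    by (simp add: assms(16) algebra_simps)
  also have "\<dots> \<le> \<Gamma> * (a / \<phi>)" 
    using \<Gamma> v \<open>u \<le> v\<close> by (intro mult_left_mono) auto
  finally have main: "1/2 * a\<^sup>2 + lam * \<gamma> * (L - \<alpha> * N) \<le> a * r" by (simp add: r_def mult.commute)

  \<comment> \<open>As \<open>N \<le> L\<close> and \<alpha> < 1, the penalty part of
    \<open>main\<close> is nonnegative; dropping it leaves
    \<open>a\<^sup>2 / 2 \<le> a * r\<close>.\<close>
  have "\<alpha> * N \<le> \<alpha> * L" using \<open>N \<le> L\<close> assms(2) by simp
  then have L: "(1 - \<alpha>) * L \<le> L - \<alpha> * N" by (simp add: algebra_simps)
  have "0 \<le> L" using \<open>N \<le> L\<close> nonneg by linarith
  then have "0 \<le> L - \<alpha> * N"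
    using L assms(3) mult_nonneg_nonneg[of "1 - \<alpha>" L] by linarith
  then have "0 \<le> lam * \<gamma> * (L - \<alpha> * N)" using lg by (simp add: mult_nonneg_nonneg)
  with main have "a * a \<le> a * (2 * r)" by (simp add: power2_eq_square)
  then have a: "a \<le> 2 * r"
    using r nonneg(1) by (cases "a = 0") auto
  have "a * r \<le> 2 * r * r"
    using a r by (intro mult_right_mono) auto
  with main have fit: "1/2 * a\<^sup>2 + lam * \<gamma> * (L - \<alpha> * N) \<le> 2 * \<Gamma>\<^sup>2 / \<phi>\<^sup>2"
    by (simp add: r_def power2_eq_square)

  \<comment> \<open>Keeping the fit term and completing the square bounds the penalty by
    \<open>r\<^sup>2 / 2\<close>, sharper than the \<open>2 * r\<^sup>2\<close> of the oracle
    inequality. Squaring this 1/2 produces the 4 in the denominator of the recovery bound.\<close>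
  have "a * r - 1/2 * a\<^sup>2 = 1/2 * r\<^sup>2 - 1/2 * (a - r)\<^sup>2"
    by (simp add: power2_eq_square algebra_simps)
  with main have "lam * \<gamma> * (L - \<alpha> * N) \<le> 1/2 * r\<^sup>2"
    using zero_le_power2[of "a - r"] by linarith
  moreover have "lam * \<gamma> * ((1 - \<alpha>) * L) \<le> lam * \<gamma> * (L - \<alpha> * N)"
    using L lg by (intro mult_left_mono) auto
  ultimately have "L * (lam * \<gamma> * (1 - \<alpha>)) \<le> \<Gamma>\<^sup>2 / (2 * \<phi>\<^sup>2)"
    by (simp add: r_def power_divide mult_ac)
  then have "L \<le> \<Gamma>\<^sup>2 / (2 * \<phi>\<^sup>2) / (lam * \<gamma> * (1 - \<alpha>))"
    using mult_pos_pos[OF lg, of "1 - \<alpha>"] assms(3) by (simp only: pos_le_divide_eq diff_gt_0_iff_gt)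
  then have "L\<^sup>2 \<le> (\<Gamma>\<^sup>2 / (2 * \<phi>\<^sup>2) / (lam * \<gamma> * (1 - \<alpha>)))\<^sup>2"
    using \<open>0 \<le> L\<close> by (rule power_mono)
  then have "L\<^sup>2 / s \<le> (\<Gamma>\<^sup>2 / (2 * \<phi>\<^sup>2) / (lam * \<gamma> * (1 - \<alpha>)))\<^sup>2 / s"
    by (rule divide_right_mono) simp
  also have "\<dots> = \<Gamma>\<^sup>2 / \<phi> ^ 4 * (\<Gamma>\<^sup>2 / (4 * real s * lam\<^sup>2 * \<gamma>\<^sup>2 * (1 - \<alpha>)\<^sup>2))"
    by (simp add: power_divide power_mult_distrib mult_ac flip: power_mult)
  finally have Ls: "L\<^sup>2 / s \<le> \<Gamma>\<^sup>2 / \<phi> ^ 4 * (\<Gamma>\<^sup>2 / (4 * real s * lam\<^sup>2 * \<gamma>\<^sup>2 * (1 - \<alpha>)\<^sup>2))" .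

  have "v \<le> 2 * r / \<phi>" using v a \<phi> by (meson divide_right_mono less_imp_le order_trans)
  then have "v\<^sup>2 \<le> (2 * r / \<phi>)\<^sup>2" by (rule power_mono) (simp add: v_def)
  also have "\<dots> = \<Gamma>\<^sup>2 / \<phi> ^ 4 * 4" by (simp add: r_def power2_eq_square eval_nat_numeral mult_ac)
  finally have vs: "v\<^sup>2 \<le> \<Gamma>\<^sup>2 / \<phi> ^ 4 * 4" .
  \<comment> \<open>Split \<open>h\<close> along \<open>S \<union> K\<close>: the head contributes
    the summand 4 through \<open>vs\<close>, the tail the quotient through
    \<open>Ls\<close>.\<close>
  have "(norm (restr (- (S \<union> K)) h))\<^sup>2 \<le> L\<^sup>2 / s"
    using largest_coords_tail[OF K] s by (simp add: L_def pos_le_divide_eq mult.commute)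
  with Ls vs norm_restr_squared_compl[of "S \<union> K" h]
  have "(norm h)\<^sup>2 \<le> \<Gamma>\<^sup>2 / \<phi> ^ 4 * (4 + \<Gamma>\<^sup>2 / (4 * real s * lam\<^sup>2 * \<gamma>\<^sup>2 * (1 - \<alpha>)\<^sup>2))"
    unfolding v_def distrib_left by linarith
  with fit show ?thesis
    unfolding a_def L_def N_def h_off unfolding \<phi>_def h_def assms(9)
    by (simp add: matrix_vector_mult_diff_distrib)
qed

end
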